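(* Let $f\in\mathfrak W$, and assume that $f(Z)>0$ and $f(Z)$ is invertible for every $Z\in\partial\mathbb K$. Then $f$ admits left and right spectral factorizations: there exist $f_+,g_+$ with $f_+^{\pm1},g_+^{\pm1}\in\mathfrak W_+$ and $f_-,g_-$ with $f_-^{\pm1},g_-^{\pm1}\in\mathfrak W_-$ such that $f=f_-f_+$ (right) and $f=g_+g_-$ (left) on $\partial\mathbb K$.
   Context: $\mathbb{BC}$ is the commutative algebra of bicomplex numbers $Z=z_1+jz_2$, $z_1,z_2\in\mathbb C$ (imaginary unit $i$), where $j^2=-1$ and $ij=ji=:k$ (so $k^2=1$). Put $\mathbf e_1=\frac{1+k}{2}$, $\mathbf e_2=\frac{1-k}{2}$; these are idempotents with $\mathbf e_1\mathbf e_2=0$, $\mathbf e_1+\mathbf e_2=1$, and every $Z=z_1+jz_2$ is uniquely $Z=\lambda_1\mathbf e_1+\lambda_2\mathbf e_2$ with $\lambda_1=z_1-iz_2$, $\lambda_2=z_1+iz_2\in\mathbb C$. Addition and multiplication are componentwise in this representation. The norm is $\|Z\|=|\lambda_1|+|\lambda_2|$. A bicomplex number $Z$ is called positive, $Z>0$, if both $\lambda_1$ and $\lambda_2$ are positive real numbers. The bicomplex unit circle is $\partial\mathbb K=\{e^{it}e^{js}: t,s\in[0,2\pi]\}\subset\mathbb{BC}$, where $e^{js}=\cos s+j\sin s$ (equivalently the set of $Z$ with $|\lambda_1|=|\lambda_2|=1$). The bicomplex Wiener algebra $\mathfrak W$ is the set of functions $f:\partial\mathbb K\to\mathbb{BC}$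 of the form $f(Z)=\sum_{n\in\mathbb Z}f_nZ^n$ with $f_n\in\mathbb{BC}$ and $\sum_{n\in\mathbb Z}\|f_n\|<\infty$, with pointwise multiplication. $\mathfrak W_+$ (resp. $\mathfrak W_-$) is the subalgebra of those $f$ of the form $\sum_{n\ge0}f_nZ^n$ (resp. $\sum_{n\ge0}f_{-n}Z^{-n}$) with absolutely summable coefficients. Here $h^{-1}$ denotes the pointwise inverse. *)

theory Defs
  imports "HOL-Analysis.Analysis"
begin

datatype bicomplex = Bicomplex (bc1: complex) (bc2: complex)

definition lam1 :: "bicomplex \<Rightarrow> complex" where
  "lam1 Z = bc1 Z - \<i> * bc2 Z"

definition lam2 :: "bicomplex \<Rightarrow> complex" where
  "lam2 Z = bc1 Z + \<i> * bc2 Z"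

lemma bicomplex_eq_iff: "Z = W \<longleftrightarrow> bc1 Z = bc1 W \<and> bc2 Z = bc2 W"
  by (cases Z; cases W) simp

lemma bicomplex_eq_iff_lam: "Z = W \<longleftrightarrow> lam1 Z = lam1 W \<and> lam2 Z = lam2 W"
proof
  assume h: "lam1 Z = lam1 W \<and> lam2 Z = lam2 W"
  have "lam1 V + lam2 V = 2 * bc1 V" "lam2 V - lam1 V = 2 * \<i> * bc2 V" for V
    by (simp_all add: lam1_def lam2_def)
  then have "2 * bc1 Z = 2 * bc1 W" "2 * \<i> * bc2 Z = 2 * \<i> * bc2 W"
    using h by metis+
  then show "Z = W" by (simp add: bicomplex_eq_iff)
qed simp

instantiation bicomplex :: comm_ring_1
begin

definition "0 = Bicomplex 0 0"
definition "1 = Bicomplex 1 0"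
definition "Z + W = Bicomplex (bc1 Z + bc1 W) (bc2 Z + bc2 W)"
definition "- Z = Bicomplex (- bc1 Z) (- bc2 Z)"
definition "Z - W = Bicomplex (bc1 Z - bc1 W) (bc2 Z - bc2 W)"
definition "Z * W = Bicomplex (bc1 Z * bc1 W - bc2 Z * bc2 W) (bc1 Z * bc2 W + bc2 Z * bc1 W)"

instance
  by standard
    (simp_all add: zero_bicomplex_def one_bicomplex_def plus_bicomplex_def uminus_bicomplex_def
      minus_bicomplex_def times_bicomplex_def algebra_simps)

end

text \<open>
  The inverse is $(z_1 - j z_2) / (z_1^2 + z_2^2)$; zero divisors, for which
  $z_1^2 + z_2^2 = \lambda_1 \lambda_2 = 0$, are sent to \<open>0\<close>.
\<close>

instantiation bicomplex :: inverse
begin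

definition "inverse Z =
  Bicomplex (bc1 Z / ((bc1 Z)\<^sup>2 + (bc2 Z)\<^sup>2)) (- bc2 Z / ((bc1 Z)\<^sup>2 + (bc2 Z)\<^sup>2))"
definition "Z div W = Z * inverse (W :: bicomplex)"

instance ..

end

lemma lam_simps [simp]:
  "lam1 0 = 0" "lam2 0 = 0" "lam1 1 = 1" "lam2 1 = 1"
  "lam1 (Z + W) = lam1 Z + lam1 W" "lam2 (Z + W) = lam2 Z + lam2 W"
  "lam1 (Z - W) = lam1 Z - lam1 W" "lam2 (Z - W) = lam2 Z - lam2 W"
  "lam1 (- Z) = - lam1 Z" "lam2 (- Z) = - lam2 Z"
  "lam1 (Z * W) = lam1 Z * lam1 W" "lam2 (Z * W) = lam2 Z * lam2 W"
  by (simp_all add: lam1_def lam2_def zero_bicomplex_def one_bicomplex_def plus_bicomplex_def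
      uminus_bicomplex_def minus_bicomplex_def times_bicomplex_def algebra_simps)

instantiation bicomplex :: real_algebra
begin

definition "scaleR r Z = Bicomplex (r *\<^sub>R bc1 Z) (r *\<^sub>R bc2 Z)"

lemma lam_scaleR [simp]: "lam1 (r *\<^sub>R Z) = r *\<^sub>R lam1 Z" "lam2 (r *\<^sub>R Z) = r *\<^sub>R lam2 Z"
  by (simp_all add: lam1_def lam2_def scaleR_bicomplex_def algebra_simps)

instance
  by standard (simp_all add: bicomplex_eq_iff_lam algebra_simps)

end

instantiation bicomplex :: real_normed_algebra
begin

definition norm_bicomplex_def: "norm Z = cmod (lam1 Z) + cmod (lam2 Z)"
definition "sgn Z = Z /\<^sub>R norm (Z :: bicomplex)"
definition "dist Z W = norm (Z - W :: bicomplex)"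
definition "uniformity = (INF e\<in>{0<..}. principal {(Z, W :: bicomplex). dist Z W < e})"
definition "open (U :: bicomplex set) \<longleftrightarrow>
  (\<forall>Z\<in>U. \<forall>\<^sub>F (Z', W) in uniformity. Z' = Z \<longrightarrow> W \<in> U)"

instance
proof
  fix Z W :: bicomplex and r :: real
  show "norm Z = 0 \<longleftrightarrow> Z = 0"
    by (simp add: norm_bicomplex_def bicomplex_eq_iff_lam add_nonneg_eq_0_iff)
  show "norm (Z + W) \<le> norm Z + norm W"
    using norm_triangle_ineq[of "lam1 Z" "lam1 W"] norm_triangle_ineq[of "lam2 Z" "lam2 W"]
    by (simp add: norm_bicomplex_def)
  show "norm (r *\<^sub>R Z) = \<bar>r\<bar> * norm Z"
    by (simp add: norm_bicomplex_def algebra_simps)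
  show "norm (Z * W) \<le> norm Z * norm W"
    by (simp add: norm_bicomplex_def norm_mult algebra_simps)
qed (fact sgn_bicomplex_def dist_bicomplex_def uniformity_bicomplex_def open_bicomplex_def)+

end

definition bc_of_complex :: "complex \<Rightarrow> bicomplex" where
  "bc_of_complex z = Bicomplex z 0"

definition bc_j :: bicomplex where
  "bc_j = Bicomplex 0 1"

definition bc_k :: bicomplex where
  "bc_k = bc_of_complex \<i> * bc_j"

definition bc_e1 :: bicomplex where
  "bc_e1 = bc_of_complex (1/2) * (1 + bc_k)"

definition bc_e2 :: bicomplex where
  "bc_e2 = bc_of_complex (1/2) * (1 - bc_k)"

lemma bicomplex_decomp: "Z = bc_of_complex (bc1 Z) + bc_j * bc_of_complex (bc2 Z)"
  by (simp add: bicomplex_eq_iff bc_of_complex_def bc_j_def plus_bicomplex_def times_bicomplex_def)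

lemma bc_j_squared: "bc_j * bc_j = - 1"
  by (simp add: bicomplex_eq_iff bc_j_def one_bicomplex_def uminus_bicomplex_def times_bicomplex_def)

lemma lam_of_complex [simp]: "lam1 (bc_of_complex z) = z" "lam2 (bc_of_complex z) = z"
  by (simp_all add: lam1_def lam2_def bc_of_complex_def)

lemma lam_j [simp]: "lam1 bc_j = - \<i>" "lam2 bc_j = \<i>"
  by (simp_all add: lam1_def lam2_def bc_j_def)

lemma bicomplex_idempotent_decomp:
  "Z = bc_of_complex (lam1 Z) * bc_e1 + bc_of_complex (lam2 Z) * bc_e2"
  by (simp add: bicomplex_eq_iff_lam bc_e1_def bc_e2_def bc_k_def)

lemma bicomplex_unit_iff: "Z dvd 1 \<longleftrightarrow> lam1 Z \<noteq> 0 \<and> lam2 Z \<noteq> 0"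
  and bicomplex_mult_inverse: "Z dvd 1 \<Longrightarrow> Z * inverse Z = 1"
proof -
  have *: "Z * inverse Z = 1" if "lam1 Z \<noteq> 0" "lam2 Z \<noteq> 0" for Z
  proof -
    have "lam1 Z * lam2 Z = (bc1 Z)\<^sup>2 + (bc2 Z)\<^sup>2"
      by (simp add: lam1_def lam2_def algebra_simps power2_eq_square)
    then have "(bc1 Z)\<^sup>2 + (bc2 Z)\<^sup>2 \<noteq> 0" using that by auto
    then show ?thesis
      by (simp add: bicomplex_eq_iff times_bicomplex_def inverse_bicomplex_def one_bicomplex_def
          power2_eq_square flip: add_divide_distrib)
  qed
  show iff: "Z dvd 1 \<longleftrightarrow> lam1 Z \<noteq> 0 \<and> lam2 Z \<noteq> 0" for Z
  proof
    assume "Z dvd 1"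
    then obtain W where "1 = Z * W" by (auto elim: dvdE)
    then have "lam1 Z * lam1 W = 1" "lam2 Z * lam2 W = 1" by (metis lam_simps)+
    then show "lam1 Z \<noteq> 0 \<and> lam2 Z \<noteq> 0" by auto
  next
    assume "lam1 Z \<noteq> 0 \<and> lam2 Z \<noteq> 0"
    then show "Z dvd 1" by (metis * dvdI)
  qed
  show "Z dvd 1 \<Longrightarrow> Z * inverse Z = 1" using * iff by blast
qed

definition bc_positive :: "bicomplex \<Rightarrow> bool" where
  "bc_positive Z \<longleftrightarrow> (\<exists>a b :: real. 0 < a \<and> 0 < b \<and>
     lam1 Z = complex_of_real a \<and> lam2 Z = complex_of_real b)"

definition bc_exp_j :: "real \<Rightarrow> bicomplex" where
  "bc_exp_j s = bc_of_complex (complex_of_real (cos s)) + bc_j * bc_of_complex (complex_of_real (sin s))"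

definition bc_circle :: "bicomplex set" where
  "bc_circle = {bc_of_complex (exp (\<i> * complex_of_real t)) * bc_exp_j s | t s.
     t \<in> {0..2 * pi} \<and> s \<in> {0..2 * pi}}"

text \<open>
  A function on the bicomplex unit circle is represented by a total function on \<open>bicomplex\<close>
  whose values outside the circle are irrelevant.
\<close>

definition bc_wiener :: "(bicomplex \<Rightarrow> bicomplex) set" where
  "bc_wiener = {f. \<exists>c :: int \<Rightarrow> bicomplex. (\<lambda>n. norm (c n)) summable_on UNIV \<and>
     (\<forall>Z\<in>bc_circle. ((\<lambda>n. c n * Z powi n) has_sum f Z) UNIV)}"

definition bc_wiener_plus :: "(bicomplex \<Rightarrow> bicomplex) set" where
  "bc_wiener_plus = {f. \<exists>c :: nat \<Rightarrow> bicomplex. (\<lambda>n. norm (c n)) summable_on UNIV \<and>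
     (\<forall>Z\<in>bc_circle. ((\<lambda>n. c n * Z ^ n) has_sum f Z) UNIV)}"

definition bc_wiener_minus :: "(bicomplex \<Rightarrow> bicomplex) set" where
  "bc_wiener_minus = {f. \<exists>c :: nat \<Rightarrow> bicomplex. (\<lambda>n. norm (c n)) summable_on UNIV \<and>
     (\<forall>Z\<in>bc_circle. ((\<lambda>n. c n * Z powi (- int n)) has_sum f Z) UNIV)}"

text \<open>
  \<open>h\<close> and its pointwise inverse both lie in \<open>A\<close>. Invertibility of the values is required
  explicitly because \<open>inverse\<close> is total.
\<close>

definition with_inverse_in ::
  "(bicomplex \<Rightarrow> bicomplex) \<Rightarrow> (bicomplex \<Rightarrow> bicomplex) set \<Rightarrow> bool" where
  "with_inverse_in h A \<longleftrightarrow>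
     h \<in> A \<and> (\<forall>Z\<in>bc_circle. h Z dvd 1) \<and> (\<lambda>Z. inverse (h Z)) \<in> A"

end

theory Submission
  imports Defs "HOL-Complex_Analysis.Cauchy_Integral_Formula"
begin

text \<open>
  In the idempotent representation a function of the bicomplex Wiener algebra is a pair of functions
  of the classical Wiener algebra, the first depending on \<open>\<lambda>\<^sub>1\<close> only and the second on \<open>\<lambda>\<^sub>2\<close> only,
  so it suffices to factor a positive scalar function \<open>F\<close> on the unit circle. Scale it so that
  \<open>h = 1 - F / B\<close> has supremum norm less than 1. The Wiener norms of the powers of \<open>h\<close> grow no faster
  than the supremum norm predicts (Newman's argument: approximate \<open>h\<close> by a Laurent polynomial, whose
  powers have linearly many coefficients, each at most the supremum of the power), hence the series
  of \<open>ln (1 - h)\<close> converges in the Wiener algebra. Splitting the logarithm into its parts with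
  nonnegative and nonpositive exponents and exponentiating both gives the factorization.
\<close>

section \<open>The scalar Wiener algebra on the unit circle, with explicit norm bounds\<close>

text \<open>
  \<open>wiener_on I f B\<close>: on the unit circle \<open>f\<close> has a Laurent series with exponents in \<open>I\<close> whose coefficients
  have \<open>\<ell>\<^sup>1\<close> norm at most \<open>B\<close>. Carrying a bound instead of the norm itself makes the convolution of
  coefficient sequences unnecessary.
\<close>

definition wiener_on :: "int set \<Rightarrow> (complex \<Rightarrow> complex) \<Rightarrow> real \<Rightarrow> bool" where
  "wiener_on I f B \<longleftrightarrow> (\<exists>c s. ((\<lambda>n. norm (c n)) has_sum s) I \<and> s \<le> B \<and>
     (\<forall>z\<in>sphere 0 1. ((\<lambda>n. c n * z powi n) has_sum f z) I))"

lemma norm_powi_sphere: "z \<in> sphere 0 1 \<Longrightarrow> norm (z powi n) = 1" for z :: complex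
  by (simp add: norm_power_int)

lemma wiener_on_mono: "wiener_on I f B \<Longrightarrow> B \<le> B' \<Longrightarrow> wiener_on I f B'"
  unfolding wiener_on_def by (meson order_trans)

lemma wiener_on_cong:
  "wiener_on I f B \<Longrightarrow> (\<And>z. z \<in> sphere 0 1 \<Longrightarrow> f z = g z) \<Longrightarrow> wiener_on I g B"
  unfolding wiener_on_def by metis

text \<open>Powers of \<open>z\<close> have modulus 1 on the circle, so the Wiener norm dominates
  the supremum. Evaluated at the point 1, this also shows that every admissible bound is
  nonnegative.\<close>

lemma norm_le_wiener_on:
  assumes "wiener_on I f B" "z \<in> sphere 0 1"
  shows "norm (f z) \<le> B"
proof -
  obtain c s where c: "((\<lambda>n. norm (c n)) has_sum s) I" "s \<le> B"
      "((\<lambda>n. c n * z powi n) has_sum f z) I"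
    using assms unfolding wiener_on_def by blast
  have "((\<lambda>n. norm (c n * z powi n)) has_sum s) I"
    using c(1) assms(2) by (simp add: norm_mult norm_powi_sphere)
  then show ?thesis
    using norm_has_sum_bound[OF _ c(3)] c(2) by force
qed

text \<open>Completeness of the algebra, by Fubini: the norm bounds make the double series of
  coefficients absolutely summable over \<open>K \<times> I\<close>, so its two iterated sums agree.
  Products, exponentials and logarithms are all obtained as such series.\<close>

lemma wiener_on_sums:
  assumes f: "\<And>k. k \<in> K \<Longrightarrow> wiener_on I (f k) (B k)"
    and B: "(B has_sum S) K"
    and g: "\<And>z. z \<in> sphere 0 1 \<Longrightarrow> ((\<lambda>k. f k z) has_sum g z) K"
  shows "wiener_on I g S"
proof -
  have "\<forall>k\<in>K. \<exists>c s. ((\<lambda>n. norm (c n)) has_sum s) I \<and> s \<le> B k \<and>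
     (\<forall>z\<in>sphere 0 1. ((\<lambda>n. c n * z powi n) has_sum f k z) I)"
    using f unfolding wiener_on_def by blast
  then obtain c s where c: "\<And>k. k \<in> K \<Longrightarrow> ((\<lambda>n. norm (c k n)) has_sum s k) I"
     "\<And>k. k \<in> K \<Longrightarrow> s k \<le> B k"
     "\<And>k z. k \<in> K \<Longrightarrow> z \<in> sphere 0 1 \<Longrightarrow> ((\<lambda>n. c k n * z powi n) has_sum f k z) I"
    by metis
  have s0: "s k \<ge> 0" if "k \<in> K" for k
    using c(1)[OF that] by (rule has_sum_nonneg) simp
  have ssum: "s summable_on K"
    using has_sum_imp_summable[OF B] by (rule summable_on_comparison_test) (use c(2) s0 in auto)
  have sm: "(\<lambda>(k,n). norm (c k n)) summable_on K \<times> I"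
    by (rule summable_on_SigmaI[where g = s]) (use c(1) ssum in auto)
  define T where "T = infsum (\<lambda>(k,n). norm (c k n)) (K \<times> I)"
  have T: "((\<lambda>(k,n). norm (c k n)) has_sum T) (K \<times> I)"
    unfolding T_def using sm by (rule has_sum_infsum)
  have T': "((\<lambda>(n,k). norm (c k n)) has_sum T) (I \<times> K)"
    using T by (subst (asm) has_sum_swap) simp
  have "(s has_sum T) K"
    using T by (rule has_sum_SigmaD) (use c(1) in auto)
  then have TS: "T \<le> S"
    using B by (rule has_sum_mono) (use c(2) in auto)
  \<comment> \<open>The coefficients of \<open>g\<close> are the columnwise sums; \<open>t\<close>
    plays the same role for the norms.\<close>
  define d where "d n = (\<Sum>\<^sub>\<infinity>k\<in>K. c k n)" for n
  have cn: "(\<lambda>k. norm (c k n)) summable_on K" if "n \<in> I" for n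
    by (rule summable_on_SigmaD1[OF has_sum_imp_summable[OF T'] that])
  have d: "((\<lambda>k. c k n) has_sum d n) K" if "n \<in> I" for n
    unfolding d_def using abs_summable_summable[OF cn[OF that]] by (rule has_sum_infsum)
  define t where "t n = (\<Sum>\<^sub>\<infinity>k\<in>K. norm (c k n))" for n
  have t: "((\<lambda>k. norm (c k n)) has_sum t n) K" if "n \<in> I" for n
    unfolding t_def using cn[OF that] by (rule has_sum_infsum)
  have tT: "(t has_sum T) I"
    using T' by (rule has_sum_SigmaD) (use t in auto)
  have dt: "norm (d n) \<le> t n" if "n \<in> I" for n
    using t[OF that] d[OF that] by (rule norm_has_sum_bound)
  have "(\<lambda>n. norm (d n)) summable_on I"
    using has_sum_imp_summable[OF tT] by (rule summable_on_comparison_test) (use dt in auto)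
  then obtain u where u: "((\<lambda>n. norm (d n)) has_sum u) I"
    by (auto simp: summable_on_def)
  have "u \<le> T"
    using u tT by (rule has_sum_mono) (use dt in auto)
  moreover have "((\<lambda>n. d n * z powi n) has_sum g z) I" if z: "z \<in> sphere 0 1" for z
  proof -
    have "(\<lambda>x. norm (case x of (k, n) \<Rightarrow> c k n * z powi n)) summable_on K \<times> I"
      using sm by (simp add: norm_mult norm_powi_sphere[OF z] case_prod_unfold)
    \<comment> \<open>Summing this double series over \<open>I\<close> first gives
      \<open>g z\<close>, summing over \<open>K\<close> first gives the series with coefficients
      \<open>d\<close>.\<close>
    then obtain V where V: "((\<lambda>(k,n). c k n * z powi n) has_sum V) (K \<times> I)"
      using abs_summable_summable by (fastforce simp: summable_on_def)
    have "((\<lambda>k. f k z) has_sum V) K"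
      using V by (rule has_sum_SigmaD) (use c(3) z in auto)
    then have "V = g z"
      using g[OF z] has_sum_unique by blast
    moreover have "((\<lambda>(n,k). c k n * z powi n) has_sum V) (I \<times> K)"
      using V by (subst (asm) has_sum_swap) simp
    then have "((\<lambda>n. d n * z powi n) has_sum V) I"
      by (rule has_sum_SigmaD) (use d in \<open>auto intro!: has_sum_cmult_left\<close>)
    ultimately show ?thesis by simp
  qed
  ultimately show ?thesis
    using u TS unfolding wiener_on_def by fastforce
qed

lemma wiener_on_const:
  assumes "0 \<in> I"
  shows "wiener_on I (\<lambda>z. a) (norm a)"
proof -
  define c where "c n = (if n = 0 then a else 0)" for n :: int
  have "((\<lambda>n. norm (c n)) has_sum norm a) I"
    using has_sum_finite[of "{0}" "\<lambda>n. norm (c n)"] assms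
    by (subst has_sum_cong_neutral[of "{0}" _ _ "\<lambda>n. norm (c n)"]) (auto simp: c_def)
  moreover have "((\<lambda>n. c n * z powi n) has_sum a) I" for z
    using has_sum_finite[of "{0}" "\<lambda>n. c n * z powi n"] assms
    by (subst has_sum_cong_neutral[of "{0}" _ _ "\<lambda>n. c n * z powi n"]) (auto simp: c_def)
  ultimately show ?thesis unfolding wiener_on_def by blast
qed

lemma wiener_on_monom_mult:
  assumes f: "wiener_on I f B" and m: "\<And>n. n \<in> I \<Longrightarrow> n + m \<in> I"
  shows "wiener_on I (\<lambda>z. a * z powi m * f z) (norm a * B)"
proof -
  obtain c s where c: "((\<lambda>n. norm (c n)) has_sum s) I" "s \<le> B"
      "\<And>z. z\<in>sphere 0 1 \<Longrightarrow> ((\<lambda>n. c n * z powi n) has_sum f z) I"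
    using f unfolding wiener_on_def by blast
  \<comment> \<open>The zero branch is needed for one-sided \<open>I\<close>, where
    \<open>n - m\<close> may leave \<open>I\<close> although \<open>n\<close> lies in it.
    Accordingly, \<open>shift\<close> reindexes to the translate of \<open>I\<close> by
    \<open>m\<close> and pads with zeros.\<close>
  define d where "d n = (if n - m \<in> I then a * c (n - m) else 0)" for n
  have shift: "(h has_sum S) I" if "((\<lambda>n. h (n + m)) has_sum S) I"
      "\<And>n. n - m \<notin> I \<Longrightarrow> h n = 0" for h :: "int \<Rightarrow> 'z::topological_comm_monoid_add" and S
  proof -
    have "(h has_sum S) ((\<lambda>n. n + m) ` I)"
      using that(1) by (subst has_sum_reindex) (auto simp: o_def)
    moreover have "n - m \<notin> I" if "n \<notin> (\<lambda>n. n + m) ` I" for n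
      using that by (metis diff_add_cancel imageI)
    ultimately show ?thesis
      using m that(2) by (subst has_sum_cong_neutral[of "(\<lambda>n. n + m) ` I" _ _ h]) auto
  qed
  have "((\<lambda>n. norm (d n)) has_sum norm a * s) I"
  proof (rule shift)
    show "((\<lambda>n. norm (d (n + m))) has_sum norm a * s) I"
      using has_sum_cmult_right[OF c(1), of "norm a"]
      by (rule has_sum_cong[THEN iffD1, rotated]) (auto simp: d_def norm_mult)
  qed (auto simp: d_def)
  moreover have "((\<lambda>n. d n * z powi n) has_sum a * z powi m * f z) I" if z: "z \<in> sphere 0 1" for z
  proof (rule shift)
    have z0: "z \<noteq> 0" using z by auto
    show "((\<lambda>n. d (n + m) * z powi (n + m)) has_sum a * z powi m * f z) I"
      using has_sum_cmult_right[OF c(3)[OF z], of "a * z powi m"]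
      by (rule has_sum_cong[THEN iffD1, rotated]) (use z0 in \<open>auto simp: d_def power_int_add\<close>)
  qed (auto simp: d_def)
  moreover have "norm a * s \<le> norm a * B"
    using c(2) by (simp add: mult_left_mono)
  ultimately show ?thesis
    unfolding wiener_on_def by blast
qed

lemma wiener_on_cmult:
  "wiener_on I f B \<Longrightarrow> wiener_on I (\<lambda>z. a * f z) (norm a * B)"
  using wiener_on_monom_mult[of I f B 0 a] by simp

lemma wiener_on_sum:
  assumes "finite K" "\<And>k. k \<in> K \<Longrightarrow> wiener_on I (f k) (B k)"
  shows "wiener_on I (\<lambda>z. \<Sum>k\<in>K. f k z) (\<Sum>k\<in>K. B k)"
  using assms(2) by (rule wiener_on_sums) (use assms(1) in auto)

lemma wiener_on_add:
  assumes "wiener_on I f A" "wiener_on I g B"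
  shows "wiener_on I (\<lambda>z. f z + g z) (A + B)"
  using wiener_on_sum[of UNIV I "\<lambda>k. if k then f else g" "\<lambda>k. if k then A else B"] assms
  by (simp add: UNIV_bool add.commute)

text \<open>The product is the series of the shifted multiples \<open>c\<^sub>n z\<^sup>n g(z)\<close>.\<close>

lemma wiener_on_mult:
  assumes I: "\<And>m n. m \<in> I \<Longrightarrow> n \<in> I \<Longrightarrow> m + n \<in> I"
    and f: "wiener_on I f A" and g: "wiener_on I g B"
  shows "wiener_on I (\<lambda>z. f z * g z) (A * B)"
proof -
  obtain c s where c: "((\<lambda>n. norm (c n)) has_sum s) I" "s \<le> A"
      "\<And>z. z\<in>sphere 0 1 \<Longrightarrow> ((\<lambda>n. c n * z powi n) has_sum f z) I"
    using f unfolding wiener_on_def by blast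
  have "0 \<le> norm (g 1)" by simp
  also have "\<dots> \<le> B" using norm_le_wiener_on[OF g] by simp
  finally have "B \<ge> 0" .
  have "wiener_on I (\<lambda>z. f z * g z) (s * B)"
  proof (rule wiener_on_sums)
    show "wiener_on I (\<lambda>z. c k * z powi k * g z) (norm (c k) * B)" if "k \<in> I" for k
      using g by (rule wiener_on_monom_mult) (use that I in auto)
  qed (use c(1,3) in \<open>auto intro: has_sum_cmult_left\<close>)
  then show ?thesis
    by (rule wiener_on_mono) (use \<open>B \<ge> 0\<close> c(2) in \<open>simp add: mult_right_mono\<close>)
qed

lemma wiener_on_power:
  assumes I: "\<And>m n. m \<in> I \<Longrightarrow> n \<in> I \<Longrightarrow> m + n \<in> I" "0 \<in> I"
    and f: "wiener_on I f B"
  shows "wiener_on I (\<lambda>z. f z ^ k) (B ^ k)"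
proof (induction k)
  case 0
  then show ?case using wiener_on_const[OF I(2), of 1] by simp
next
  case (Suc k)
  then show ?case using wiener_on_mult[OF I(1) f] by simp
qed

text \<open>The exponential series is summed termwise, which turns the bounds \<open>B ^ k\<close>
  into \<open>exp B\<close>. Closure of \<open>I\<close> under addition keeps the exponential of a
  one-sided function one-sided, as the spectral factors require.\<close>

lemma wiener_on_exp:
  assumes I: "\<And>m n. m \<in> I \<Longrightarrow> n \<in> I \<Longrightarrow> m + n \<in> I" "0 \<in> I"
    and f: "wiener_on I f B"
  shows "wiener_on I (\<lambda>z. exp (f z)) (exp B)"
proof (rule wiener_on_sums)
  show "wiener_on I (\<lambda>z. (1 / fact k) * f z ^ k) (norm (1 / fact k :: complex) * B ^ k)" for k
    by (intro wiener_on_cmult wiener_on_power assms) auto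
  have "0 \<le> norm (f 1)" by simp
  also have "\<dots> \<le> B" using norm_le_wiener_on[OF f] by simp
  finally have "B \<ge> 0" .
  then show "((\<lambda>k. norm (1 / fact k :: complex) * B ^ k) has_sum exp B) UNIV"
    using exp_converges[of B]
    by (intro sums_nonneg_imp_has_sum) (auto simp: norm_divide norm_fact field_simps)
  show "((\<lambda>k. 1 / fact k * f z ^ k) has_sum exp (f z)) UNIV" for z
    using exp_converges[of "f z"] summable_norm_exp[of "f z"]
    by (intro norm_summable_imp_has_sum)
      (auto simp: norm_divide norm_power norm_mult scaleR_conv_of_real divide_inverse mult.commute)
qed

text \<open>The constant term goes to \<open>g\<close>.\<close>

lemma wiener_on_split:
  assumes "wiener_on UNIV f B"
  obtains g h where "wiener_on {0..} g B" "wiener_on {..0} h B"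
    "\<And>z. z \<in> sphere 0 1 \<Longrightarrow> f z = g z + h z"
proof -
  obtain c s where c: "((\<lambda>n. norm (c n)) has_sum s) UNIV" "s \<le> B"
      "\<And>z. z\<in>sphere 0 1 \<Longrightarrow> ((\<lambda>n. c n * z powi n) has_sum f z) UNIV"
    using assms unfolding wiener_on_def by blast
  \<comment> \<open>Stated for any \<open>d\<close> dominated by \<open>c\<close>, to serve both for
    the coefficients themselves and for those with the constant term removed.\<close>
  have part: "\<exists>g. wiener_on I g B \<and> (\<forall>z\<in>sphere 0 1. ((\<lambda>n. d n * z powi n) has_sum g z) I)"
    if d: "\<And>n. norm (d n) \<le> norm (c n)" for I and d :: "int \<Rightarrow> complex"
  proof -
    have sm: "(\<lambda>n. norm (c n)) summable_on I"
      using summable_on_subset[OF has_sum_imp_summable[OF c(1)]] by blast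
    have "(\<lambda>n. norm (d n)) summable_on I"
      using sm by (rule summable_on_comparison_test) (use d in auto)
    then obtain u where u: "((\<lambda>n. norm (d n)) has_sum u) I"
      by (auto simp: summable_on_def)
    have "u \<le> s"
      using u c(1) by (rule has_sum_mono_neutral) (use d in auto)
    moreover have "(\<lambda>n. d n * z powi n) summable_on I" if "z \<in> sphere 0 1" for z
      by (rule abs_summable_summable)
        (use u in \<open>auto simp: norm_mult norm_powi_sphere[OF that] summable_on_def\<close>)
    then have "\<forall>z\<in>sphere 0 1. ((\<lambda>n. d n * z powi n) has_sum (\<Sum>\<^sub>\<infinity>n\<in>I. d n * z powi n)) I"
      by simp
    ultimately show ?thesis
      using u c(2) unfolding wiener_on_def by fastforce
  qed
  obtain g where g: "wiener_on {0..} g B"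
      "\<And>z. z\<in>sphere 0 1 \<Longrightarrow> ((\<lambda>n. c n * z powi n) has_sum g z) {0..}"
    using part[of c "{0..}"] by auto
  obtain h where h: "wiener_on {..0} h B"
      "\<And>z. z\<in>sphere 0 1 \<Longrightarrow> ((\<lambda>n. (if n = 0 then 0 else c n) * z powi n) has_sum h z) {..0}"
    using part[of "\<lambda>n. if n = 0 then 0 else c n" "{..0}"] by force
  have "f z = g z + h z" if z: "z \<in> sphere 0 1" for z
  proof -
    \<comment> \<open>Its constant coefficient being zero, \<open>h\<close> is the sum over the
      strictly negative exponents, which are disjoint from those of \<open>g\<close>.\<close>
    have "((\<lambda>n. c n * z powi n) has_sum h z) {..<0}"
      using h(2)[OF z] by (rule has_sum_cong_neutral[THEN iffD1, rotated 3]) auto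
    then have "((\<lambda>n. c n * z powi n) has_sum g z + h z) ({0..} \<union> {..<0})"
      using g(2)[OF z] by (intro has_sum_Un_disjoint) auto
    moreover have "{0..} \<union> {..<0} = (UNIV :: int set)" by auto
    ultimately show ?thesis
      using c(3)[OF z] has_sum_unique by metis
  qed
  with g(1) h(1) show ?thesis using that by blast
qed

section \<open>Newman's estimate for the Wiener norms of powers\<close>

text \<open>Cauchy's inequality at the origin with radius 1, since the \<open>k\<close>-th
  derivative there is \<open>fact k\<close> times the coefficient.\<close>

lemma norm_coeff_le:
  fixes p :: "complex poly"
  assumes "\<And>z. z \<in> sphere 0 1 \<Longrightarrow> norm (poly p z) \<le> M"
  shows "norm (coeff p k) \<le> M"
proof -
  have deriv: "(deriv ^^ k) (poly p) = poly ((pderiv ^^ k) p)"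
    by (induction k) (auto intro!: DERIV_imp_deriv poly_DERIV)
  have "norm ((deriv ^^ k) (poly p) 0) \<le> fact k * M / 1 ^ k"
    by (rule Cauchy_inequality) (use assms in \<open>auto intro!: holomorphic_intros continuous_intros\<close>)
  then have "fact k * norm (coeff p k) \<le> fact k * M"
    by (simp add: deriv poly_0_coeff_0 coeff_higher_pderiv norm_mult norm_fact flip: pochhammer_fact)
  then show ?thesis by simp
qed

text \<open>Each coefficient is bounded by the supremum, so passing from the supremum to the Wiener
  norm costs only the number of coefficients. This is linear in the degree, a loss that powers do
  not amplify.\<close>

lemma wiener_on_laurent_polynomial:
  assumes "\<And>z. z \<in> sphere 0 1 \<Longrightarrow> norm (poly p z) \<le> M" and "degree p \<le> D"
  shows "wiener_on UNIV (\<lambda>z. z powi m * poly p z) (real (D + 1) * M)"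
proof -
  \<comment> \<open>The trailing factor 1 presents each monomial as a multiple of a constant
    function, in the form of \<open>wiener_on_monom_mult\<close>.\<close>
  have "wiener_on UNIV (\<lambda>z. \<Sum>k\<le>D. coeff p k * z powi (m + int k) * 1)
      (\<Sum>k\<le>D. norm (coeff p k) * norm (1::complex))"
    by (intro wiener_on_sum wiener_on_monom_mult wiener_on_const) auto
  then have "wiener_on UNIV (\<lambda>z. z powi m * poly p z) (\<Sum>k\<le>D. norm (coeff p k) * norm (1::complex))"
  proof (rule wiener_on_cong)
    fix z :: complex assume "z \<in> sphere 0 1"
    then have "z \<noteq> 0" by auto
    have "poly p z = (\<Sum>k\<le>D. coeff p k * z ^ k)"
      unfolding poly_altdef using assms(2) by (intro sum.mono_neutral_left) (auto simp: coeff_eq_0)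
    then show "(\<Sum>k\<le>D. coeff p k * z powi (m + int k) * 1) = z powi m * poly p z"
      using \<open>z \<noteq> 0\<close> by (auto simp: power_int_add sum_distrib_left mult_ac)
  qed
  moreover have "(\<Sum>k\<le>D. norm (coeff p k) * norm (1::complex)) \<le> (\<Sum>k\<le>D. M)"
    using norm_coeff_le[OF assms(1)] by (intro sum_mono) auto
  ultimately show ?thesis
    by (auto intro: wiener_on_mono)
qed

text \<open>Write \<open>f\<close> as a Laurent polynomial \<open>P\<close> plus an error of Wiener
  norm at most \<open>\<epsilon>\<close>. Powers of \<open>P\<close> exceed their supremum bound by
  a linear factor only, powers of the error are bounded directly, and the binomial theorem combines
  the two. The growth rate is thus any \<open>\<rho>\<close> above \<open>r\<close>, where
  submultiplicativity alone gives \<open>B\<close>.\<close>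

lemma wiener_on_power_spectral_bound:
  assumes f: "wiener_on UNIV f B" and r: "\<And>z. z \<in> sphere 0 1 \<Longrightarrow> norm (f z) \<le> r" and "r < \<rho>"
  obtains d :: nat where "\<And>n. wiener_on UNIV (\<lambda>z. f z ^ n) (real (2 * n * d + 1) * \<rho> ^ n)"
proof -
  \<comment> \<open>Half of the gap allows for the supremum of \<open>P\<close> exceeding
    \<open>r\<close>, the other half for the Wiener norm of the error.\<close>
  define \<epsilon> where "\<epsilon> = (\<rho> - r) / 2"
  have \<epsilon>: "\<epsilon> > 0" "\<rho> = (r + \<epsilon>) + \<epsilon>" using \<open>r < \<rho>\<close> by (auto simp: \<epsilon>_def field_simps)
  have "0 \<le> norm (f 1)" by simp
  also have "\<dots> \<le> r" using r by simp
  finally have "r \<ge> 0" .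
  obtain c s where c: "((\<lambda>n. norm (c n)) has_sum s) UNIV"
      "\<And>z. z\<in>sphere 0 1 \<Longrightarrow> ((\<lambda>n. c n * z powi n) has_sum f z) UNIV"
    using f unfolding wiener_on_def by blast
  obtain F where F: "finite F" "dist (\<Sum>n\<in>F. norm (c n)) s \<le> \<epsilon>"
    using has_sum_finite_approximation[OF c(1) \<epsilon>(1)] by blast
  define P where "P z = (\<Sum>n\<in>F. c n * z powi n)" for z
  \<comment> \<open>The largest absolute value of an exponent in \<open>P\<close>; inserting 0
    covers an empty \<open>F\<close>.\<close>
  define d where "d = Max (insert 0 ((\<lambda>n. nat \<bar>n\<bar>) ` F))"
  have d: "\<bar>n\<bar> \<le> int d" if "n \<in> F" for n
  proof -
    have "nat \<bar>n\<bar> \<le> d" unfolding d_def using F(1) that by (intro Max_ge) auto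
    then show ?thesis by linarith
  qed
  have E: "wiener_on UNIV (\<lambda>z. f z - P z) \<epsilon>"
  proof -
    define c' where "c' n = (if n \<in> F then 0 else c n)" for n
    have "((\<lambda>n. norm (c n)) has_sum s - (\<Sum>n\<in>F. norm (c n))) (UNIV - F)"
      using c(1) F(1) by (intro has_sum_Diff has_sum_finite) auto
    then have "((\<lambda>n. norm (c' n)) has_sum s - (\<Sum>n\<in>F. norm (c n))) UNIV"
      by (rule has_sum_cong_neutral[THEN iffD1, rotated 3]) (auto simp: c'_def)
    moreover have "((\<lambda>n. c' n * z powi n) has_sum f z - P z) UNIV" if z: "z \<in> sphere 0 1" for z
    proof -
      have "((\<lambda>n. c n * z powi n) has_sum f z - P z) (UNIV - F)"
        unfolding P_def using c(2)[OF z] F(1) by (intro has_sum_Diff has_sum_finite) auto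
      then show ?thesis
        by (rule has_sum_cong_neutral[THEN iffD1, rotated 3]) (auto simp: c'_def)
    qed
    moreover have "s - (\<Sum>n\<in>F. norm (c n)) \<le> \<epsilon>"
      using F(2) by (simp add: dist_real_def)
    ultimately show ?thesis unfolding wiener_on_def by blast
  qed
  \<comment> \<open>Clearing the negative exponents makes the Cauchy bound for polynomials applicable.\<close>
  define Q where "Q = (\<Sum>n\<in>F. monom (c n) (nat (n + int d)))"
  have degQ: "degree Q \<le> 2 * d"
    unfolding Q_def
  proof (intro degree_sum_le F(1))
    fix n assume "n \<in> F"
    then show "degree (monom (c n) (nat (n + int d))) \<le> 2 * d"
      using d[of n] by (intro order_trans[OF degree_monom_le]) auto
  qed
  have Q: "poly Q z = z powi int d * P z" if z: "z \<in> sphere 0 1" for z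
  proof -
    have "z \<noteq> 0" using z by auto
    have "z ^ nat (n + int d) = z powi int d * z powi n" if "n \<in> F" for n
    proof -
      have "z ^ nat (n + int d) = z powi (n + int d)"
        using d[OF that] by (simp add: power_int_def)
      then show ?thesis using \<open>z \<noteq> 0\<close> by (simp add: power_int_add)
    qed
    then show ?thesis
      by (simp add: Q_def P_def poly_sum poly_monom sum_distrib_left mult_ac)
  qed
  have normP: "norm (P z) \<le> r + \<epsilon>" if z: "z \<in> sphere 0 1" for z
    using norm_le_wiener_on[OF E z] r[OF z] norm_triangle_ineq4[of "f z" "f z - P z"] by simp
  \<comment> \<open>On the circle \<open>P ^ k\<close> is \<open>Q ^ k\<close> divided by the power
    \<open>d * k\<close> of \<open>z\<close>, and \<open>Q ^ k\<close> has degree at most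
    \<open>2 * k * d\<close>.\<close>
  have Pk: "wiener_on UNIV (\<lambda>z. P z ^ k) (real (2 * k * d + 1) * (r + \<epsilon>) ^ k)" for k
  proof (rule wiener_on_cong[OF wiener_on_laurent_polynomial])
    fix z :: complex assume z: "z \<in> sphere 0 1"
    show "norm (poly (Q ^ k) z) \<le> (r + \<epsilon>) ^ k"
      using normP[OF z] by (simp add: Q[OF z] norm_mult norm_power power_mono z[simplified])
    have "z \<noteq> 0" using z by auto
    then show "z powi (- int (d * k)) * poly (Q ^ k) z = P z ^ k"
      by (simp add: Q[OF z] power_mult_distrib power_int_minus flip: power_mult del: of_nat_mult)
  next
    show "degree (Q ^ k) \<le> 2 * k * d"
      using order_trans[OF degree_power_le[of Q k] mult_le_mono1[OF degQ, of k]] by (simp add: mult_ac)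
  qed
  have "wiener_on UNIV (\<lambda>z. f z ^ n) (real (2 * n * d + 1) * \<rho> ^ n)" for n
  proof -
    have "wiener_on UNIV (\<lambda>z. \<Sum>k\<le>n. of_nat (n choose k) * (P z ^ k * (f z - P z) ^ (n - k)))
        (\<Sum>k\<le>n. norm (of_nat (n choose k) :: complex) *
          ((real (2 * k * d + 1) * (r + \<epsilon>) ^ k) * \<epsilon> ^ (n - k)))"
      by (intro wiener_on_sum wiener_on_cmult wiener_on_mult wiener_on_power Pk E) auto
    then have "wiener_on UNIV (\<lambda>z. f z ^ n)
        (\<Sum>k\<le>n. norm (of_nat (n choose k) :: complex) *
          ((real (2 * k * d + 1) * (r + \<epsilon>) ^ k) * \<epsilon> ^ (n - k)))"
    proof (rule wiener_on_cong)
      show "(\<Sum>k\<le>n. of_nat (n choose k) * (P z ^ k * (f z - P z) ^ (n - k))) = f z ^ n" for z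
        using binomial_ring[of "P z" "f z - P z" n] by (simp add: mult.assoc)
    qed
    \<comment> \<open>Replacing \<open>k\<close> by \<open>n\<close> in the linear factor makes it
      independent of \<open>k\<close>, so that the rest is the expansion of
      \<open>\<rho> ^ n\<close>.\<close>
    moreover have "(\<Sum>k\<le>n. norm (of_nat (n choose k) :: complex) *
          ((real (2 * k * d + 1) * (r + \<epsilon>) ^ k) * \<epsilon> ^ (n - k)))
        \<le> (\<Sum>k\<le>n. of_nat (n choose k) * ((real (2 * n * d + 1) * (r + \<epsilon>) ^ k) * \<epsilon> ^ (n - k)))"
      using \<epsilon>(1) \<open>r \<ge> 0\<close> by (intro sum_mono) (auto intro!: mult_left_mono mult_right_mono)
    moreover have "\<dots> = real (2 * n * d + 1) * \<rho> ^ n"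
      unfolding \<epsilon>(2) binomial_ring[of "r + \<epsilon>" \<epsilon> n] by (simp add: sum_distrib_left mult_ac)
    ultimately show ?thesis by (auto intro: wiener_on_mono)
  qed
  then show ?thesis using that by blast
qed

section \<open>The logarithm and the scalar factorization\<close>

text \<open>The logarithm series converges in the Wiener norm because powers of \<open>h\<close>
  decay geometrically there, even if \<open>B\<close> exceeds 1. As \<open>h\<close> has modulus
  below 1 on the circle, the sum is the principal branch.\<close>

lemma wiener_on_Ln:
  assumes h: "wiener_on UNIV h B" and r: "\<And>z. z \<in> sphere 0 1 \<Longrightarrow> norm (h z) \<le> r" and "r < 1"
  shows "\<exists>C. wiener_on UNIV (\<lambda>z. Ln (1 - h z)) C"
proof -
  obtain \<rho> where \<rho>: "r < \<rho>" "\<rho> < 1" using \<open>r < 1\<close> dense by blast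
  have "0 \<le> norm (h 1)" by simp
  also have "\<dots> \<le> r" using r by simp
  finally have "\<rho> > 0" using \<rho> by simp
  obtain d :: nat where d: "\<And>n. wiener_on UNIV (\<lambda>z. h z ^ n) (real (2 * n * d + 1) * \<rho> ^ n)"
    using wiener_on_power_spectral_bound[OF h r \<rho>(1)] by blast
  have "wiener_on UNIV (\<lambda>z. Ln (1 - h z)) (real (2 * d + 1) * (1 / (1 - \<rho>)))"
  proof (rule wiener_on_sums)
    \<comment> \<open>The factor \<open>1 / n\<close> absorbs the linear growth of the Newman bound.
      At \<open>n = 0\<close> division by zero yields 0, matching the absent constant term.\<close>
    show "wiener_on UNIV (\<lambda>z. (- 1 / of_nat n) * h z ^ n) (real (2 * d + 1) * \<rho> ^ n)" for n
    proof (rule wiener_on_mono[OF wiener_on_cmult[OF d]])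
      have "norm (- 1 / of_nat n :: complex) * real (2 * n * d + 1) \<le> real (2 * d + 1)"
        by (cases "n = 0") (auto simp: norm_divide field_simps)
      then show "norm (- 1 / of_nat n :: complex) * (real (2 * n * d + 1) * \<rho> ^ n)
          \<le> real (2 * d + 1) * \<rho> ^ n"
        using \<open>\<rho> > 0\<close> by (simp add: mult_right_mono flip: mult.assoc)
    qed
    show "((\<lambda>n. real (2 * d + 1) * \<rho> ^ n) has_sum real (2 * d + 1) * (1 / (1 - \<rho>))) UNIV"
      using \<rho> \<open>\<rho> > 0\<close> by (intro has_sum_cmult_right sums_nonneg_imp_has_sum geometric_sums) auto
    fix z :: complex assume z: "z \<in> sphere 0 1"
    have hz: "norm (h z) < 1" using r[OF z] \<open>r < 1\<close> by simp
    show "((\<lambda>n. - 1 / of_nat n * h z ^ n) has_sum Ln (1 - h z)) UNIV"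
    proof (rule norm_summable_imp_has_sum)
      show "(\<lambda>n. - 1 / of_nat n * h z ^ n) sums Ln (1 - h z)"
        using Ln_series'[of "- h z"] hz by simp
      show "summable (\<lambda>n. norm (- 1 / of_nat n * h z ^ n))"
      proof (rule summable_comparison_test')
        show "summable (\<lambda>n. norm (h z) ^ n)" using hz by (simp add: summable_geometric)
        show "norm (norm (- 1 / of_nat n * h z ^ n)) \<le> norm (h z) ^ n" for n
          by (cases "n = 0") (auto simp: norm_mult norm_divide norm_power divide_simps mult_le_cancel_right1 mult_le_cancel_left1)
      qed
    qed
  qed
  then show ?thesis by blast
qed

text \<open>The Weierstrass M-test gives uniform convergence. Continuity supplies the positive
  minimum of a positive function on the circle.\<close>

lemma wiener_on_continuous:
  assumes "wiener_on I f B"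
  shows "continuous_on (sphere 0 1) f"
proof -
  obtain c s where c: "((\<lambda>n. norm (c n)) has_sum s) I"
      "\<And>z. z\<in>sphere 0 1 \<Longrightarrow> ((\<lambda>n. c n * z powi n) has_sum f z) I"
    using assms unfolding wiener_on_def by blast
  have "uniform_limit (sphere 0 1) (\<lambda>X z. \<Sum>n\<in>X. c n * z powi n) f (finite_subsets_at_top I)"
    by (rule Weierstrass_m_test_general'[where M = "\<lambda>n. norm (c n)"])
      (use c in \<open>auto simp: norm_mult norm_powi_sphere summable_on_def simp del: mem_sphere mem_sphere_0\<close>)
  moreover have "continuous_on (sphere 0 1) (\<lambda>z. \<Sum>n\<in>X. c n * z powi n)" for X
    by (intro continuous_intros) auto
  ultimately show ?thesis
    by (intro uniform_limit_theorem[rotated]) auto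
qed

text \<open>Factors of the form \<open>exp p\<close> and \<open>exp q\<close> come with their
  inverses, the exponentials of \<open>- p\<close> and \<open>- q\<close>, so invertibility within
  the one-sided algebras is automatic.\<close>

lemma wiener_on_positive_factorization:
  assumes F: "wiener_on UNIV F B"
    and pos: "\<And>z. z \<in> sphere 0 1 \<Longrightarrow> \<exists>a>0. F z = complex_of_real a"
  obtains p q A where "wiener_on {0..} (\<lambda>z. exp (p z)) A" "wiener_on {0..} (\<lambda>z. exp (- p z)) A"
    "wiener_on {..0} (\<lambda>z. exp (q z)) A" "wiener_on {..0} (\<lambda>z. exp (- q z)) A"
    "\<And>z. z \<in> sphere 0 1 \<Longrightarrow> F z = exp (q z) * exp (p z)"
proof -
  have F': "F z = complex_of_real (Re (F z))" "Re (F z) > 0" if "z \<in> sphere 0 1" for z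
    using pos[OF that] by auto
  have cont: "continuous_on (sphere 0 1) (\<lambda>z. Re (F z))"
    using wiener_on_continuous[OF F] by (intro continuous_intros)
  have ne: "sphere 0 1 \<noteq> ({} :: complex set)" by simp
  obtain w where w: "w \<in> sphere 0 1" "\<And>z. z \<in> sphere 0 1 \<Longrightarrow> Re (F w) \<le> Re (F z)"
    using continuous_attains_inf[OF compact_sphere ne cont] by blast
  define \<delta> where "\<delta> = Re (F w)"
  have \<delta>: "\<delta> > 0" "\<And>z. z \<in> sphere 0 1 \<Longrightarrow> \<delta> \<le> Re (F z)"
    using w F'(2) by (auto simp: \<delta>_def)
  have FB: "Re (F z) \<le> B" if "z \<in> sphere 0 1" for z
    using norm_le_wiener_on[OF F that] complex_Re_le_cmod[of "F z"] by linarith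
  then have B: "B > 0" using \<delta> w(1) by (force simp: \<delta>_def)
  \<comment> \<open>\<open>B\<close> bounds the Wiener norm and hence the supremum, so
    \<open>F z / B\<close> lies between \<open>\<delta> / B\<close> and 1 on the circle.\<close>
  define h where "h z = 1 - F z / of_real B" for z
  have "wiener_on UNIV (\<lambda>z. 1 + (- 1 / of_real B) * F z)
      (norm (1::complex) + norm (- 1 / of_real B :: complex) * B)"
    by (intro wiener_on_add wiener_on_const wiener_on_cmult F) auto
  then have h: "wiener_on UNIV h (norm (1::complex) + norm (- 1 / of_real B :: complex) * B)"
    by (rule wiener_on_cong) (simp add: h_def)
  have hr: "norm (h z) \<le> 1 - \<delta> / B" if z: "z \<in> sphere 0 1" for z
  proof -
    have "h z = of_real (1 - Re (F z) / B)"
      unfolding h_def by (subst F'(1)[OF z]) simp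
    then have "norm (h z) = \<bar>1 - Re (F z) / B\<bar>" by (simp only: norm_of_real)
    also have "\<dots> \<le> 1 - \<delta> / B"
      using \<delta>(2)[OF z] FB[OF z] B by (simp add: field_simps)
    finally show ?thesis .
  qed
  obtain C where C: "wiener_on UNIV (\<lambda>z. Ln (1 - h z)) C"
    using wiener_on_Ln[OF h hr] \<delta> B by auto
  have expL: "exp (Ln (1 - h z)) = F z / of_real B" if "z \<in> sphere 0 1" for z
    using F'[OF that] B by (subst exp_Ln) (auto simp: h_def)
  obtain p q where pq: "wiener_on {0..} p C" "wiener_on {..0} q C"
    "\<And>z. z \<in> sphere 0 1 \<Longrightarrow> Ln (1 - h z) = p z + q z"
    using wiener_on_split[OF C] by metis
  \<comment> \<open>The scaling factor \<open>B\<close> returns as the constant \<open>ln B\<close>,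
    added here to the part with nonnegative exponents.\<close>
  define p' where "p' z = p z + of_real (ln B)" for z
  have p': "wiener_on {0..} p' (C + \<bar>ln B\<bar>)"
    using wiener_on_add[OF pq(1) wiener_on_const[of "{0..}" "of_real (ln B)"]]
    by (simp add: p'_def[abs_def])
  have q: "wiener_on {..0} q (C + \<bar>ln B\<bar>)"
    using pq(2) by (rule wiener_on_mono) simp
  have neg: "wiener_on I (\<lambda>z. - u z) D" if "wiener_on I u D" for I u D
    using wiener_on_cmult[OF that, of "-1"] by simp
  show ?thesis
  proof (rule that)
    show "wiener_on {0..} (\<lambda>z. exp (p' z)) (exp (C + \<bar>ln B\<bar>))"
         "wiener_on {0..} (\<lambda>z. exp (- p' z)) (exp (C + \<bar>ln B\<bar>))"
         "wiener_on {..0} (\<lambda>z. exp (q z)) (exp (C + \<bar>ln B\<bar>))"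
         "wiener_on {..0} (\<lambda>z. exp (- q z)) (exp (C + \<bar>ln B\<bar>))"
      by (intro wiener_on_exp neg p' q; simp)+
    fix z :: complex assume z: "z \<in> sphere 0 1"
    have "exp (q z) * exp (p' z) = exp (p z + q z) * exp (of_real (ln B))"
      by (simp add: p'_def exp_add mult_ac)
    also have "\<dots> = F z"
      using B by (simp add: expL[OF z] pq(3)[OF z, symmetric] exp_of_real)
    finally show "F z = exp (q z) * exp (p' z)" ..
  qed
qed

section \<open>Transfer between bicomplex functions and their idempotent components\<close>

definition bc_of_lam :: "complex \<Rightarrow> complex \<Rightarrow> bicomplex" where
  "bc_of_lam a b = bc_of_complex a * bc_e1 + bc_of_complex b * bc_e2"

lemma lam_bc_of_lam [simp]: "lam1 (bc_of_lam a b) = a" "lam2 (bc_of_lam a b) = b"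
  by (simp_all add: bc_of_lam_def bc_e1_def bc_e2_def bc_k_def)

lemma norm_bc_of_lam: "norm (bc_of_lam a b) = norm a + norm b"
  by (simp add: norm_bicomplex_def)

lemma bounded_linear_lam: "bounded_linear lam1" "bounded_linear lam2"
  by (rule bounded_linear_intro[of _ 1]; simp add: norm_bicomplex_def)+

lemma has_sum_bicomplex:
  assumes "((\<lambda>n. lam1 (f n)) has_sum lam1 S) A" "((\<lambda>n. lam2 (f n)) has_sum lam2 S) A"
  shows "(f has_sum S) A"
proof -
  have "bounded_linear (\<lambda>a. bc_of_lam a 0)" "bounded_linear (\<lambda>b. bc_of_lam 0 b)"
    by (rule bounded_linear_intro[of _ 1]; simp add: norm_bc_of_lam bicomplex_eq_iff_lam)+
  then have "((\<lambda>n. bc_of_lam (lam1 (f n)) 0 + bc_of_lam 0 (lam2 (f n))) has_sum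
      bc_of_lam (lam1 S) 0 + bc_of_lam 0 (lam2 S)) A"
    using assms by (intro has_sum_add) (auto intro: has_sum_bounded_linear)
  moreover have "bc_of_lam (lam1 Z) 0 + bc_of_lam 0 (lam2 Z) = Z" for Z
    by (simp add: bicomplex_eq_iff_lam)
  ultimately show ?thesis by simp
qed

lemma lam_power [simp]: "lam1 (Z ^ n) = lam1 Z ^ n" "lam2 (Z ^ n) = lam2 Z ^ n"
  by (induction n) auto

lemma lam_inverse:
  assumes "Z dvd 1"
  shows "lam1 (inverse Z) = inverse (lam1 Z)" "lam2 (inverse Z) = inverse (lam2 Z)"
proof -
  have "lam1 Z * lam1 (inverse Z) = 1" "lam2 Z * lam2 (inverse Z) = 1"
    using bicomplex_mult_inverse[OF assms] by (metis lam_simps)+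
  then show "lam1 (inverse Z) = inverse (lam1 Z)" "lam2 (inverse Z) = inverse (lam2 Z)"
    by (metis inverse_unique)+
qed

text \<open>Negative exponents go through \<open>inverse\<close>, which acts componentwise at units
  but sends zero divisors to 0.\<close>

lemma lam_powi:
  assumes "Z dvd 1"
  shows "lam1 (Z powi n) = lam1 Z powi n" "lam2 (Z powi n) = lam2 Z powi n"
  by (simp_all add: power_int_def lam_inverse[OF assms])

lemma bc_circle_lam:
  assumes "Z \<in> bc_circle"
  shows "lam1 Z \<in> sphere 0 1" "lam2 Z \<in> sphere 0 1" "Z dvd 1"
proof -
  obtain t s where Z: "Z = bc_of_complex (exp (\<i> * complex_of_real t)) * bc_exp_j s"
    using assms by (auto simp: bc_circle_def)
  have "lam1 (bc_exp_j s) = cis (- s)" "lam2 (bc_exp_j s) = cis s"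
    by (simp_all add: bc_exp_j_def complex_eq_iff)
  then have "norm (lam1 Z) = 1" "norm (lam2 Z) = 1"
    by (simp_all add: Z norm_mult)
  then show "lam1 Z \<in> sphere 0 1" "lam2 Z \<in> sphere 0 1" "Z dvd 1"
    by (auto simp: bicomplex_unit_iff)
qed

text \<open>Points with both components equal to \<open>z\<close>, obtained with
  \<open>s = 0\<close>; they suffice to recover each scalar component function.\<close>

lemma bc_of_complex_in_bc_circle:
  assumes "z \<in> sphere 0 1"
  shows "bc_of_complex z \<in> bc_circle"
proof -
  obtain t where t: "0 \<le> t" "t < 2 * pi" "z = exp (\<i> * complex_of_real t)"
    using assms complex_unimodular_polar[of z]
    by (metis cis.ctr cis_conv_exp mem_sphere_0)
  have "bc_of_complex z = bc_of_complex (exp (\<i> * complex_of_real t)) * bc_exp_j 0"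
    by (simp add: t(3) bicomplex_eq_iff_lam bc_exp_j_def)
  then show ?thesis
    unfolding bc_circle_def using t by force
qed

text \<open>Integer exponents from a set \<open>I\<close> allow one treatment of both one-sided
  algebras; the next two lemmas pass to the indexing by natural numbers.\<close>

definition bc_wiener_on :: "int set \<Rightarrow> (bicomplex \<Rightarrow> bicomplex) set" where
  "bc_wiener_on I = {f. \<exists>c :: int \<Rightarrow> bicomplex. (\<lambda>n. norm (c n)) summable_on I \<and>
     (\<forall>Z\<in>bc_circle. ((\<lambda>n. c n * Z powi n) has_sum f Z) I)}"

lemma bc_wiener_on_subset_plus: "bc_wiener_on {0..} \<subseteq> bc_wiener_plus"
proof
  fix f assume "f \<in> bc_wiener_on {0..}"
  then obtain c :: "int \<Rightarrow> bicomplex" where c: "(\<lambda>n. norm (c n)) summable_on {0..}"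
      "\<And>Z. Z \<in> bc_circle \<Longrightarrow> ((\<lambda>n. c n * Z powi n) has_sum f Z) {0..}"
    unfolding bc_wiener_on_def by blast
  have bij: "bij_betw int UNIV {0..}"
    by (rule bij_betwI[of _ _ _ nat]) auto
  have "(\<lambda>n. norm (c (int n))) summable_on UNIV"
    using c(1) by (subst summable_on_reindex_bij_betw[OF bij])
  moreover have "((\<lambda>n. c (int n) * Z ^ n) has_sum f Z) UNIV" if "Z \<in> bc_circle" for Z
    using c(2)[OF that] by (subst (asm) has_sum_reindex_bij_betw[OF bij, symmetric]) simp
  ultimately show "f \<in> bc_wiener_plus"
    unfolding bc_wiener_plus_def by (auto intro!: exI[of _ "\<lambda>n. c (int n)"])
qed

lemma bc_wiener_on_subset_minus: "bc_wiener_on {..0} \<subseteq> bc_wiener_minus"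
proof
  fix f assume "f \<in> bc_wiener_on {..0}"
  then obtain c :: "int \<Rightarrow> bicomplex" where c: "(\<lambda>n. norm (c n)) summable_on {..0}"
      "\<And>Z. Z \<in> bc_circle \<Longrightarrow> ((\<lambda>n. c n * Z powi n) has_sum f Z) {..0}"
    unfolding bc_wiener_on_def by blast
  have bij: "bij_betw (\<lambda>n. - int n) UNIV {..0}"
    by (rule bij_betwI[of _ _ _ "\<lambda>m. nat (- m)"]) auto
  have "(\<lambda>n. norm (c (- int n))) summable_on UNIV"
    using c(1) by (subst summable_on_reindex_bij_betw[OF bij])
  moreover have "((\<lambda>n. c (- int n) * Z powi (- int n)) has_sum f Z) UNIV" if "Z \<in> bc_circle" for Z
    using c(2)[OF that] by (subst (asm) has_sum_reindex_bij_betw[OF bij, symmetric]) simp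
  ultimately show "f \<in> bc_wiener_minus"
    unfolding bc_wiener_minus_def
    by (auto intro!: exI[of _ "\<lambda>n. c (- int n)"])
qed

lemma bc_of_lam_in_bc_wiener_on:
  assumes "wiener_on I u A" "wiener_on I v B"
    and f: "\<And>Z. Z \<in> bc_circle \<Longrightarrow> f Z = bc_of_lam (u (lam1 Z)) (v (lam2 Z))"
  shows "f \<in> bc_wiener_on I"
proof -
  obtain c s where c: "((\<lambda>n. norm (c n)) has_sum s) I"
      "\<And>z. z\<in>sphere 0 1 \<Longrightarrow> ((\<lambda>n. c n * z powi n) has_sum u z) I"
    using assms(1) unfolding wiener_on_def by blast
  obtain d t where d: "((\<lambda>n. norm (d n)) has_sum t) I"
      "\<And>z. z\<in>sphere 0 1 \<Longrightarrow> ((\<lambda>n. d n * z powi n) has_sum v z) I"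
    using assms(2) unfolding wiener_on_def by blast
  have "(\<lambda>n. norm (bc_of_lam (c n) (d n))) summable_on I"
    using has_sum_add[OF c(1) d(1)] by (auto simp: norm_bc_of_lam summable_on_def)
  moreover have "((\<lambda>n. bc_of_lam (c n) (d n) * Z powi n) has_sum f Z) I" if "Z \<in> bc_circle" for Z
    using that c(2) d(2)
    by (intro has_sum_bicomplex) (auto simp: f lam_powi bc_circle_lam simp del: mem_sphere mem_sphere_0)
  ultimately show ?thesis
    unfolding bc_wiener_on_def by (auto intro!: exI[of _ "\<lambda>n. bc_of_lam (c n) (d n)"])
qed

lemma with_inverse_in_bc_wiener_on_exp:
  assumes "wiener_on I (\<lambda>z. exp (u z)) A" "wiener_on I (\<lambda>z. exp (- u z)) A"
    and "wiener_on I (\<lambda>z. exp (v z)) B" "wiener_on I (\<lambda>z. exp (- v z)) B"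
  shows "with_inverse_in (\<lambda>Z. bc_of_lam (exp (u (lam1 Z))) (exp (v (lam2 Z)))) (bc_wiener_on I)"
proof -
  have unit: "bc_of_lam (exp a) (exp b) dvd 1" for a b
    by (simp add: bicomplex_unit_iff)
  have "inverse (bc_of_lam (exp a) (exp b)) = bc_of_lam (exp (- a)) (exp (- b))" for a b
    by (simp add: bicomplex_eq_iff_lam lam_inverse[OF unit] exp_minus)
  then show ?thesis
    unfolding with_inverse_in_def using unit assms
    by (auto intro: bc_of_lam_in_bc_wiener_on)
qed

text \<open>Each idempotent component is a ring homomorphism, so it turns the series of
  \<open>f\<close> into a scalar series in that component of \<open>Z\<close> alone.\<close>

lemma bc_wiener_components:
  assumes "f \<in> bc_wiener"
  obtains F1 F2 B where "wiener_on UNIV F1 B" "wiener_on UNIV F2 B"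
    "\<And>Z. Z \<in> bc_circle \<Longrightarrow> f Z = bc_of_lam (F1 (lam1 Z)) (F2 (lam2 Z))"
proof -
  obtain c :: "int \<Rightarrow> bicomplex" where c: "(\<lambda>n. norm (c n)) summable_on UNIV"
      "\<And>Z. Z \<in> bc_circle \<Longrightarrow> ((\<lambda>n. c n * Z powi n) has_sum f Z) UNIV"
    using assms unfolding bc_wiener_def by blast
  define B where "B = (\<Sum>\<^sub>\<infinity>n. norm (c n))"
  \<comment> \<open>The hypotheses on \<open>l\<close> are those shared by \<open>lam1\<close> and
    \<open>lam2\<close>, which are handled together.\<close>
  have comp: "\<exists>F. wiener_on UNIV F B \<and> (\<forall>Z\<in>bc_circle. l (f Z) = F (l Z))"
    if bl: "bounded_linear l" and le: "\<And>Z. norm (l Z) \<le> norm Z"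
      and mult: "\<And>Z W. l (Z * W) = l Z * l W" and powi: "\<And>Z n. Z dvd 1 \<Longrightarrow> l (Z powi n) = l Z powi n"
      and sph: "\<And>Z. Z \<in> bc_circle \<Longrightarrow> l Z \<in> sphere 0 1" and l: "\<And>z. l (bc_of_complex z) = z"
    for l :: "bicomplex \<Rightarrow> complex"
  proof -
    have sum: "((\<lambda>n. l (c n) * l Z powi n) has_sum l (f Z)) UNIV" if "Z \<in> bc_circle" for Z
      using has_sum_bounded_linear[OF bl c(2)[OF that]] that by (simp add: mult powi bc_circle_lam(3))
    \<comment> \<open>Sampling at diagonal points defines \<open>F\<close>; uniqueness of sums then
      identifies \<open>l (f Z)\<close> with \<open>F (l Z)\<close> at every point of the bicomplex
      circle.\<close>
    define F where "F z = l (f (bc_of_complex z))" for z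
    have F: "((\<lambda>n. l (c n) * z powi n) has_sum F z) UNIV" if "z \<in> sphere 0 1" for z
      using sum[OF bc_of_complex_in_bc_circle[OF that]] by (simp add: F_def l)
    have "(\<lambda>n. norm (l (c n))) summable_on UNIV"
      using c(1) by (rule summable_on_comparison_test) (use le in auto)
    then obtain s where s: "((\<lambda>n. norm (l (c n))) has_sum s) UNIV"
      by (auto simp: summable_on_def)
    have "s \<le> B"
      using s has_sum_infsum[OF c(1)] unfolding B_def by (rule has_sum_mono) (use le in auto)
    then have "wiener_on UNIV F B"
      using s F unfolding wiener_on_def by (intro exI[of _ "\<lambda>n. l (c n)"]) blast
    moreover have "l (f Z) = F (l Z)" if "Z \<in> bc_circle" for Z
      using sum[OF that] F[OF sph[OF that]] has_sum_unique by blast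
    ultimately show ?thesis by blast
  qed
  obtain F1 where F1: "wiener_on UNIV F1 B" "\<forall>Z\<in>bc_circle. lam1 (f Z) = F1 (lam1 Z)"
    using comp[OF bounded_linear_lam(1)]
    by (auto simp: norm_bicomplex_def lam_powi bc_circle_lam simp del: mem_sphere mem_sphere_0)
  obtain F2 where F2: "wiener_on UNIV F2 B" "\<forall>Z\<in>bc_circle. lam2 (f Z) = F2 (lam2 Z)"
    using comp[OF bounded_linear_lam(2)]
    by (auto simp: norm_bicomplex_def lam_powi bc_circle_lam simp del: mem_sphere mem_sphere_0)
  show ?thesis
    using that[OF F1(1) F2(1)] F1(2) F2(2) by (simp add: bicomplex_eq_iff_lam)
qed

theorem theorem1p19:
  fixes f :: "bicomplex \<Rightarrow> bicomplex"
  assumes "f \<in> bc_wiener"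
    and "\<And>Z. Z \<in> bc_circle \<Longrightarrow> bc_positive (f Z)"
    and "\<And>Z. Z \<in> bc_circle \<Longrightarrow> f Z dvd 1"
  shows "\<exists>f_plus g_plus f_minus g_minus.
    with_inverse_in f_plus bc_wiener_plus \<and> with_inverse_in g_plus bc_wiener_plus \<and>
    with_inverse_in f_minus bc_wiener_minus \<and> with_inverse_in g_minus bc_wiener_minus \<and>
    (\<forall>Z\<in>bc_circle. f Z = f_minus Z * f_plus Z) \<and>
    (\<forall>Z\<in>bc_circle. f Z = g_plus Z * g_minus Z)"
proof -
  obtain F1 F2 B where F: "wiener_on UNIV F1 B" "wiener_on UNIV F2 B"
    "\<And>Z. Z \<in> bc_circle \<Longrightarrow> f Z = bc_of_lam (F1 (lam1 Z)) (F2 (lam2 Z))"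
    by (rule bc_wiener_components[OF assms(1)]) (rule that)
  have pos: "\<exists>a>0. F1 z = complex_of_real a" "\<exists>a>0. F2 z = complex_of_real a"
    if "z \<in> sphere 0 1" for z
    using assms(2)[OF bc_of_complex_in_bc_circle[OF that]] F(3)[OF bc_of_complex_in_bc_circle[OF that]]
    by (auto simp: bc_positive_def)
  obtain p1 q1 A1 where 1: "wiener_on {0..} (\<lambda>z. exp (p1 z)) A1"
    "wiener_on {0..} (\<lambda>z. exp (- p1 z)) A1"
    "wiener_on {..0} (\<lambda>z. exp (q1 z)) A1" "wiener_on {..0} (\<lambda>z. exp (- q1 z)) A1"
    "\<And>z. z \<in> sphere 0 1 \<Longrightarrow> F1 z = exp (q1 z) * exp (p1 z)"
    by (rule wiener_on_positive_factorization[OF F(1) pos(1)]) (assumption | rule that)+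
  obtain p2 q2 A2 where 2: "wiener_on {0..} (\<lambda>z. exp (p2 z)) A2"
    "wiener_on {0..} (\<lambda>z. exp (- p2 z)) A2"
    "wiener_on {..0} (\<lambda>z. exp (q2 z)) A2" "wiener_on {..0} (\<lambda>z. exp (- q2 z)) A2"
    "\<And>z. z \<in> sphere 0 1 \<Longrightarrow> F2 z = exp (q2 z) * exp (p2 z)"
    by (rule wiener_on_positive_factorization[OF F(2) pos(2)]) (assumption | rule that)+
  define fp where "fp Z = bc_of_lam (exp (p1 (lam1 Z))) (exp (p2 (lam2 Z)))" for Z
  define fm where "fm Z = bc_of_lam (exp (q1 (lam1 Z))) (exp (q2 (lam2 Z)))" for Z
  have "with_inverse_in fp (bc_wiener_on {0..})" "with_inverse_in fm (bc_wiener_on {..0})"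
    unfolding fp_def fm_def by (rule with_inverse_in_bc_wiener_on_exp; rule 1 2)+
  then have "with_inverse_in fp bc_wiener_plus" "with_inverse_in fm bc_wiener_minus"
    using bc_wiener_on_subset_plus bc_wiener_on_subset_minus unfolding with_inverse_in_def
    by (auto simp: subset_iff)
  moreover have "f Z = fm Z * fp Z" if "Z \<in> bc_circle" for Z
    using that by (simp add: F(3) bicomplex_eq_iff_lam fp_def fm_def 1(5) 2(5) bc_circle_lam
      del: mem_sphere mem_sphere_0)
  \<comment> \<open>Multiplication commutes, so the same pair with its factors exchanged is also a
    left factorization.\<close>
  ultimately show ?thesis
    by (metis mult.commute)
qed

end
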